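(* Let $0\le\alpha\le\frac12$ and let $G$ be a strongly connected digraph of order $n\ge5$ which is neither a bicyclic digraph nor the directed cycle $C_n$. Then $\lambda_\alpha(G)>\lambda_\alpha(\theta(0,2,n-4))$.
   Context: All digraphs are simple. For a digraph $G$, $A(G)$ is its adjacency matrix and $D(G)$ the diagonal matrix of outdegrees; $A_\alpha(G)=\alpha D(G)+(1-\alpha)A(G)$ and $\lambda_\alpha(G)$ is the largest modulus of an eigenvalue of $A_\alpha(G)$. A bicyclic digraph here means a strongly connected digraph $G$ with $|E(G)|=|V(G)|+1$. For integers $a,b,c\ge0$ with $a+b+c+2=n$, $\theta(a,b,c)$ is the digraph with two vertices $u,v$, two internally disjoint directed paths from $v$ to $u$ with $a$ and $b$ internal vertices, and a directed path from $u$ to $v$ with $c$ internal vertices, internally disjoint from the other two. *)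

theory Defs
  imports
    "Graph_Theory.Graph_Theory"
    "Jordan_Normal_Form.Spectral_Radius"
begin

text \<open>Matrices attached to a digraph are indexed by positions in a list \<open>vs\<close> enumerating its
  vertices. Their spectra do not depend on the enumeration; see \<open>lambda_alpha_enum\<close> below.\<close>

definition adjacency_mat :: "('a, 'b) pre_digraph \<Rightarrow> 'a list \<Rightarrow> real mat" where
  "adjacency_mat G vs =
     mat (length vs) (length vs) (\<lambda>(i, j). if vs ! i \<rightarrow>\<^bsub>G\<^esub> vs ! j then 1 else 0)"

definition outdegree_mat :: "('a, 'b) pre_digraph \<Rightarrow> 'a list \<Rightarrow> real mat" where
  "outdegree_mat G vs =
     mat (length vs) (length vs) (\<lambda>(i, j). if i = j then real (out_degree G (vs ! i)) else 0)"

definition A_alpha :: "real \<Rightarrow> ('a, 'b) pre_digraph \<Rightarrow> 'a list \<Rightarrow> real mat" where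
  "A_alpha \<alpha> G vs = \<alpha> \<cdot>\<^sub>m outdegree_mat G vs + (1 - \<alpha>) \<cdot>\<^sub>m adjacency_mat G vs"

definition vertex_enum :: "('a, 'b) pre_digraph \<Rightarrow> 'a list" where
  "vertex_enum G = (SOME vs. distinct vs \<and> set vs = verts G)"

definition lambda_alpha :: "real \<Rightarrow> ('a, 'b) pre_digraph \<Rightarrow> real" where
  "lambda_alpha \<alpha> G = spectral_radius (map_mat complex_of_real (A_alpha \<alpha> G (vertex_enum G)))"

definition bicyclic :: "('a, 'b) pre_digraph \<Rightarrow> bool" where
  "bicyclic G \<longleftrightarrow> digraph G \<and> strongly_connected G \<and> card (arcs G) = card (verts G) + 1"

definition path_arcs :: "'a list \<Rightarrow> ('a \<times> 'a) set" where
  "path_arcs xs = set (zip xs (tl xs))"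

definition directed_cycle :: "nat \<Rightarrow> (nat, nat \<times> nat) pre_digraph" where
  "directed_cycle n =
     \<lparr> verts = {0..<n}, arcs = path_arcs ([0..<n] @ [0]), tail = fst, head = snd \<rparr>"

text \<open>In \<open>theta a b c\<close> the branch vertices are \<open>u = 0\<close> and \<open>v = 1\<close>. Arcs are pairs of vertices, so
  for \<open>a = b = 0\<close> the two parallel arcs from \<open>v\<close> to \<open>u\<close> would be identified; that case is not a
  simple digraph.\<close>

definition theta :: "nat \<Rightarrow> nat \<Rightarrow> nat \<Rightarrow> (nat, nat \<times> nat) pre_digraph" where
  "theta a b c =
     \<lparr> verts = {0..<a + b + c + 2},
       arcs = path_arcs (1 # [2..<2 + a] @ [0])
            \<union> path_arcs (1 # [2 + a..<2 + a + b] @ [0])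
            \<union> path_arcs (0 # [2 + a + b..<2 + a + b + c] @ [1]),
       tail = fst, head = snd \<rparr>"

lemma eigenvalue_mat_enum:
  fixes f :: "'a \<Rightarrow> 'a \<Rightarrow> complex"
  assumes "distinct vs"
  shows "eigenvalue (mat (length vs) (length vs) (\<lambda>(i, j). f (vs ! i) (vs ! j))) k \<longleftrightarrow>
    (\<exists>x. (\<exists>u\<in>set vs. x u \<noteq> 0) \<and> (\<forall>u\<in>set vs. (\<Sum>w\<in>set vs. f u w * x w) = k * x u))"
proof -
  define n where "n = length vs"
  let ?M = "mat n n (\<lambda>(i, j). f (vs ! i) (vs ! j))"
  have bij: "bij_betw (\<lambda>i. vs ! i) {0..<n} (set vs)"
    using assms bij_betw_nth[of vs "{0..<n}" "set vs"] by (auto simp: n_def lessThan_atLeast0)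
  have sum_eq: "(\<Sum>w\<in>set vs. g w) = (\<Sum>j = 0..<n. g (vs ! j))" for g :: "'a \<Rightarrow> complex"
    using sum.reindex_bij_betw[OF bij, of g] by simp
  have mv: "(?M *\<^sub>v y) $ i = (\<Sum>j = 0..<n. f (vs ! i) (vs ! j) * y $ j)"
    if "dim_vec y = n" "i < n" for y i
    using that by (simp add: scalar_prod_def)
  have "eigenvalue ?M k \<longleftrightarrow> (\<exists>y. dim_vec y = n \<and> y \<noteq> 0\<^sub>v n \<and> ?M *\<^sub>v y = k \<cdot>\<^sub>v y)"
    unfolding eigenvalue_def eigenvector_def carrier_vec_def by simp
  also have "\<dots> \<longleftrightarrow> (\<exists>x. (\<exists>u\<in>set vs. x u \<noteq> 0) \<and>
      (\<forall>u\<in>set vs. (\<Sum>w\<in>set vs. f u w * x w) = k * x u))" (is "?L \<longleftrightarrow> ?R")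
  proof
    assume ?L
    then obtain y where y: "dim_vec y = n" "y \<noteq> 0\<^sub>v n" "?M *\<^sub>v y = k \<cdot>\<^sub>v y" by blast
    define x where "x u = y $ (the_inv_into {0..<n} (\<lambda>i. vs ! i) u)" for u
    have x: "x (vs ! i) = y $ i" if "i < n" for i
      using that bij by (auto simp: x_def bij_betw_def the_inv_into_f_f)
    obtain i where i: "i < n" "y $ i \<noteq> 0" using y(1,2) by (auto simp: vec_eq_iff)
    have "\<exists>u\<in>set vs. x u \<noteq> 0"
      using i x[of i] by (intro bexI[of _ "vs ! i"]) (auto simp: n_def)
    moreover have "(\<Sum>w\<in>set vs. f u w * x w) = k * x u" if "u \<in> set vs" for u
    proof -
      have "\<exists>j. j < n \<and> vs ! j = u" using that unfolding n_def in_set_conv_nth .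
      then obtain j where j: "j < n" "vs ! j = u" by (elim exE conjE)
      have "(\<Sum>w\<in>set vs. f u w * x w) = (\<Sum>i = 0..<n. f (vs ! j) (vs ! i) * y $ i)"
        unfolding sum_eq j(2)[symmetric] by (rule sum.cong) (auto simp: x)
      also have "\<dots> = (?M *\<^sub>v y) $ j" using mv[OF y(1) j(1)] by (rule sym)
      also have "\<dots> = k * x u" unfolding y(3) using j y(1) x[of j] by simp
      finally show ?thesis .
    qed
    ultimately show ?R by blast
  next
    assume ?R
    then obtain x where x: "\<exists>u\<in>set vs. x u \<noteq> 0"
      "\<forall>u\<in>set vs. (\<Sum>w\<in>set vs. f u w * x w) = k * x u" by blast
    define y where "y = vec n (\<lambda>i. x (vs ! i))"
    have "y \<noteq> 0\<^sub>v n" using x(1) by (auto simp: y_def vec_eq_iff in_set_conv_nth n_def)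
    moreover have "?M *\<^sub>v y = k \<cdot>\<^sub>v y"
    proof (rule eq_vecI)
      fix i assume "i < dim_vec (k \<cdot>\<^sub>v y)"
      then have i: "i < n" by (simp add: y_def)
      then have "(?M *\<^sub>v y) $ i = (\<Sum>j = 0..<n. f (vs ! i) (vs ! j) * x (vs ! j))"
        by (subst mv) (auto simp: y_def)
      also have "\<dots> = k * x (vs ! i)"
        using bspec[OF x(2), of "vs ! i"] i unfolding sum_eq by (simp add: n_def)
      finally show "(?M *\<^sub>v y) $ i = (k \<cdot>\<^sub>v y) $ i" using i by (simp add: y_def)
    qed (simp add: y_def)
    ultimately show ?L by (intro exI[of _ y]) (simp add: y_def)
  qed
  finally show ?thesis by (simp add: n_def)
qed

lemma lambda_alpha_enum:
  assumes "distinct vs" "set vs = verts G"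
  shows "lambda_alpha \<alpha> G = spectral_radius (map_mat complex_of_real (A_alpha \<alpha> G vs))"
proof -
  define f where "f u w = complex_of_real (\<alpha> * (if u = w then real (out_degree G u) else 0)
    + (1 - \<alpha>) * (if u \<rightarrow>\<^bsub>G\<^esub> w then 1 else 0))" for u w
  have A: "map_mat complex_of_real (A_alpha \<alpha> G ws)
      = mat (length ws) (length ws) (\<lambda>(i, j). f (ws ! i) (ws ! j))" if "distinct ws" for ws
    by (rule eq_matI) (use that in \<open>auto simp: A_alpha_def adjacency_mat_def outdegree_mat_def
      f_def nth_eq_iff_index_eq\<close>)
  have "distinct (vertex_enum G) \<and> set (vertex_enum G) = verts G"
    unfolding vertex_enum_def by (rule someI[of _ vs]) (use assms in simp)
  then have "eigenvalue (map_mat complex_of_real (A_alpha \<alpha> G (vertex_enum G)))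
      = eigenvalue (map_mat complex_of_real (A_alpha \<alpha> G vs))"
    using assms by (intro ext) (simp only: A eigenvalue_mat_enum)
  then show ?thesis
    by (simp only: lambda_alpha_def spectral_radius_def spectrum_def)
qed

end

theory Submission
  imports Defs
begin

text \<open>
  Put \<open>s = \<alpha> / (1 - \<alpha>)\<close> and \<open>\<rho> = \<alpha> + (1 - \<alpha>) t\<close>. The digraph \<open>\<theta>(0, 2, n - 4)\<close> has spectral radius
  \<open>\<rho>\<close> for the root \<open>t\<close> in \<open>(1, 2)\<close> of \<open>(t - s) t^(n - 1) = t^2 + 1\<close>, with an explicit positive
  eigenvector. A digraph \<open>G\<close> as in the theorem has at least \<open>n + 2\<close> arcs, and by the Collatz-Wielandt
  bound it suffices to find a positive \<open>x\<close> with \<open>A x \<ge> \<rho> x\<close>, strictly somewhere.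

  Fix a vertex \<open>v\<close> with at least two out-neighbours and let \<open>x u = t^(n - 1 - d(u, v))\<close>, where \<open>d\<close> is
  the directed distance. The inequality then holds at every \<open>u \<noteq> v\<close>, because of the next vertex on a
  shortest path, and it holds at \<open>v\<close> as soon as some out-neighbour of \<open>v\<close> is at distance at most
  \<open>n - 3\<close> from \<open>v\<close>. It uses only \<open>n + 1\<close> arcs, hence is strict somewhere.

  If there is no such vertex, then the distances to \<open>v\<close> determine \<open>G\<close> almost completely, and \<open>G\<close> contains
  arcs \<open>a \<rightarrow> b\<close>, \<open>a \<rightarrow> c\<close>, \<open>b \<rightarrow> c\<close>, \<open>b \<rightarrow> d\<close> (two consecutive chords of a Hamiltonian cycle); there the
  distance vector to \<open>a\<close>, increased at \<open>b\<close>, works because \<open>t < 2\<close>.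
\<close>

section \<open>Collatz-Wielandt bounds for nonnegative matrices\<close>

text \<open>If the spectral radius were at most \<rho>, then dividing \<open>A\<close> by some \<nu>
  > \<rho> would give a matrix \<open>R\<close> with bounded powers. But \<nu> can be chosen so that
  \<open>R\<close> still stretches \<open>x\<close> by a factor \<open>q > 1\<close> in every entry,
  and nonnegativity lets this be iterated to growth like \<open>q ^ k\<close>.\<close>

lemma spectral_radius_greaterI:
  fixes A :: "real mat" and x :: "nat \<Rightarrow> real"
  assumes A: "A \<in> carrier_mat n n" and n: "n > 0"
    and nonneg: "\<And>i j. i < n \<Longrightarrow> j < n \<Longrightarrow> 0 \<le> A $$ (i, j)"
    and pos: "\<And>i. i < n \<Longrightarrow> 0 < x i"
    and mu: "0 < \<rho>"
    and gt: "\<And>i. i < n \<Longrightarrow> \<rho> * x i < (\<Sum>j<n. A $$ (i, j) * x j)"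
  shows "\<rho> < spectral_radius (map_mat complex_of_real A)"
proof (rule ccontr)
  assume "\<not> ?thesis"
  then have le: "spectral_radius (map_mat complex_of_real A) \<le> \<rho>" by simp
  \<comment> \<open>The smallest Collatz-Wielandt quotient of \<open>x\<close>. As it is a minimum
    over finitely many indices, the strict inequalities give \<rho> < \<kappa>, which leaves room
    for \<nu> in between.\<close>
  define \<kappa> where "\<kappa> = Min ((\<lambda>i. (\<Sum>j<n. A $$ (i, j) * x j) / x i) ` {..<n})"
  have \<kappa>: "\<kappa> * x i \<le> (\<Sum>j<n. A $$ (i, j) * x j)" if "i < n" for i
  proof -
    have "\<kappa> \<le> (\<Sum>j<n. A $$ (i, j) * x j) / x i"
      unfolding \<kappa>_def using that by (intro Min_le) auto
    with pos[OF that] show ?thesis by (simp add: field_simps)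
  qed
  have "\<rho> < \<kappa>"
    unfolding \<kappa>_def using n gt pos by (subst Min_gr_iff) (auto simp: field_simps)
  then obtain \<nu> where \<nu>: "\<rho> < \<nu>" "\<nu> < \<kappa>" using dense by blast
  have \<nu>0: "\<nu> > 0" using mu \<nu> by simp
  define R where "R = (1 / \<nu>) \<cdot>\<^sub>m A"
  define B where "B = map_mat complex_of_real R"
  have R: "R \<in> carrier_mat n n" and B: "B \<in> carrier_mat n n"
    using A by (auto simp: R_def B_def)
  have "spectral_radius B < 1"
  proof -
    obtain k where k: "eigenvalue B k" "spectral_radius B = norm k"
      using spectral_radius_mem_max(1)[OF B n] by (auto simp: spectrum_def)
    then obtain v where v: "v \<in> carrier_vec n" "v \<noteq> 0\<^sub>v n" "B *\<^sub>v v = k \<cdot>\<^sub>v v"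
      using B by (auto simp: eigenvalue_def eigenvector_def)
    have AB: "map_mat complex_of_real A = of_real \<nu> \<cdot>\<^sub>m B"
      using \<nu>0 A by (intro eq_matI) (auto simp: B_def R_def)
    have "map_mat complex_of_real A *\<^sub>v v = (of_real \<nu> * k) \<cdot>\<^sub>v v"
    proof -
      have "(of_real \<nu> \<cdot>\<^sub>m B) *\<^sub>v v = of_real \<nu> \<cdot>\<^sub>v (B *\<^sub>v v)"
        using v(1) B by (intro eq_vecI) (auto simp: scalar_prod_def sum_distrib_left mult_ac)
      then show ?thesis unfolding AB v(3) by (simp add: smult_smult_assoc)
    qed
    then have "eigenvalue (map_mat complex_of_real A) (of_real \<nu> * k)"
      using v A by (auto simp: eigenvalue_def eigenvector_def)
    then have "norm (of_real \<nu> * k) \<le> spectral_radius (map_mat complex_of_real A)"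
      using A n by (intro spectral_radius_mem_max(2)[of _ n]) (auto simp: spectrum_def)
    with le \<nu>0 have "\<nu> * norm k \<le> \<rho>" by (simp add: norm_mult)
    with \<nu> have "\<nu> * norm k < \<nu> * 1" by simp
    with \<nu>0 k show ?thesis by (simp only: mult_less_cancel_left_pos)
  qed
  from spectral_radius_jnf_norm_bound_less_1_upper_triangular[OF B this]
  obtain c where c: "\<And>k. norm_bound (B ^\<^sub>m k) c" by blast
  have Bk: "B ^\<^sub>m k = map_mat complex_of_real (R ^\<^sub>m k)" for k
    unfolding B_def by (rule of_real_hom.mat_hom_pow[OF R, symmetric])
  have Rk: "(R ^\<^sub>m Suc k) $$ (i, j) = (\<Sum>l<n. (R ^\<^sub>m k) $$ (i, l) * R $$ (l, j))"
    if "i < n" "j < n" for i j k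
    using that R by (simp add: scalar_prod_def lessThan_atLeast0)
  have Rnn: "0 \<le> R $$ (i, j)" if "i < n" "j < n" for i j
    using that nonneg \<nu>0 A by (simp add: R_def)
  have Rknn: "0 \<le> (R ^\<^sub>m k) $$ (i, j)" if "i < n" "j < n" for i j k
    using that
  proof (induction k arbitrary: i j)
    case 0
    then show ?case using R by simp
  next
    case (Suc k)
    then show ?case unfolding Rk[OF Suc.prems] by (intro sum_nonneg mult_nonneg_nonneg Rnn) auto
  qed
  define q where "q = \<kappa> / \<nu>"
  have q: "q > 1" using \<nu> \<nu>0 by (simp add: q_def)
  have Rx: "q * x l \<le> (\<Sum>j<n. R $$ (l, j) * x j)" if "l < n" for l
  proof -
    have "(\<Sum>j<n. R $$ (l, j) * x j) = (\<Sum>j<n. A $$ (l, j) * x j) / \<nu>"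
      unfolding sum_divide_distrib using that A by (intro sum.cong) (auto simp: R_def)
    with \<kappa>[OF that] \<nu>0 show ?thesis by (simp add: q_def field_simps)
  qed
  have growth: "q ^ k * x i \<le> (\<Sum>j<n. (R ^\<^sub>m k) $$ (i, j) * x j)" if "i < n" for i k
  proof (induction k)
    case 0
    have "(\<Sum>j<n. (R ^\<^sub>m 0) $$ (i, j) * x j) = (\<Sum>j<n. if j = i then x j else 0)"
      using that R by (intro sum.cong) auto
    then show ?case using that by simp
  next
    case (Suc k)
    have "q ^ Suc k * x i \<le> q * (\<Sum>l<n. (R ^\<^sub>m k) $$ (i, l) * x l)"
      using Suc q by (simp add: mult.assoc)
    also have "\<dots> = (\<Sum>l<n. (R ^\<^sub>m k) $$ (i, l) * (q * x l))"
      by (simp add: sum_distrib_left mult_ac)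
    also have "\<dots> \<le> (\<Sum>l<n. (R ^\<^sub>m k) $$ (i, l) * (\<Sum>j<n. R $$ (l, j) * x j))"
      using that by (intro sum_mono mult_left_mono Rx Rknn) auto
    also have "\<dots> = (\<Sum>l<n. \<Sum>j<n. (R ^\<^sub>m k) $$ (i, l) * R $$ (l, j) * x j)"
      by (simp add: sum_distrib_left mult_ac)
    also have "\<dots> = (\<Sum>j<n. (\<Sum>l<n. (R ^\<^sub>m k) $$ (i, l) * R $$ (l, j)) * x j)"
      unfolding sum_distrib_right by (rule sum.swap)
    also have "\<dots> = (\<Sum>j<n. (R ^\<^sub>m Suc k) $$ (i, j) * x j)"
      using that by (intro sum.cong) (auto simp only: Rk lessThan_iff)
    finally show ?case .
  qed
  have bounded: "q ^ k * x 0 \<le> (\<Sum>j<n. c * x j)" for k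
  proof -
    have "(R ^\<^sub>m k) $$ (0, j) \<le> c" if "j < n" for j
    proof -
      have "norm ((B ^\<^sub>m k) $$ (0, j)) \<le> c"
        using c[of k] n that B unfolding norm_bound_def by simp
      then show ?thesis unfolding Bk using n that R by simp
    qed
    then have "(\<Sum>j<n. (R ^\<^sub>m k) $$ (0, j) * x j) \<le> (\<Sum>j<n. c * x j)"
      using pos by (intro sum_mono mult_right_mono) (auto simp: less_imp_le)
    with growth[OF n, of k] show ?thesis by simp
  qed
  obtain k where "(\<Sum>j<n. c * x j) / x 0 < q ^ k"
    using real_arch_pow[OF q] by blast
  with bounded[of k] pos[OF n] show False by (simp add: field_simps)
qed

text \<open>Take an eigenvector \<open>v\<close> for an eigenvalue of maximal modulus and the least
  \<open>M\<close> with \<open>norm (v $ i)\<close> at most \<open>M * x i\<close> for all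
  \<open>i\<close>. At an index attaining \<open>M\<close>, the triangle inequality in the
  eigenvalue equation bounds the modulus by \<rho>.\<close>

lemma spectral_radius_leI:
  fixes A :: "real mat" and x :: "nat \<Rightarrow> real"
  assumes A: "A \<in> carrier_mat n n" and n: "n > 0"
    and nonneg: "\<And>i j. i < n \<Longrightarrow> j < n \<Longrightarrow> 0 \<le> A $$ (i, j)"
    and pos: "\<And>i. i < n \<Longrightarrow> 0 < x i"
    and le: "\<And>i. i < n \<Longrightarrow> (\<Sum>j<n. A $$ (i, j) * x j) \<le> \<rho> * x i"
  shows "spectral_radius (map_mat complex_of_real A) \<le> \<rho>"
proof -
  let ?B = "map_mat complex_of_real A"
  have B: "?B \<in> carrier_mat n n" using A by simp
  obtain k where k: "eigenvalue ?B k" "spectral_radius ?B = norm k"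
    using spectral_radius_mem_max(1)[OF B n] by (auto simp: spectrum_def)
  then obtain v where v: "v \<in> carrier_vec n" "v \<noteq> 0\<^sub>v n" "?B *\<^sub>v v = k \<cdot>\<^sub>v v"
    using B by (auto simp: eigenvalue_def eigenvector_def)
  define M where "M = Max ((\<lambda>i. norm (v $ i) / x i) ` {..<n})"
  have M: "norm (v $ i) \<le> M * x i" if "i < n" for i
  proof -
    have "norm (v $ i) / x i \<le> M" unfolding M_def using that by (intro Max_ge) auto
    with pos[OF that] show ?thesis by (simp add: field_simps)
  qed
  have "M \<in> (\<lambda>i. norm (v $ i) / x i) ` {..<n}" unfolding M_def using n by (intro Max_in) auto
  then obtain i where i: "i < n" "M = norm (v $ i) / x i" by blast
  obtain j where j: "j < n" "v $ j \<noteq> 0" using v by (auto simp: vec_eq_iff)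
  have "0 < norm (v $ j)" using j by simp
  also have "\<dots> \<le> M * x j" using M j by simp
  finally have "M > 0" using pos[OF j(1)] by (simp add: zero_less_mult_iff)
  have "norm k * norm (v $ i) = norm ((?B *\<^sub>v v) $ i)"
    unfolding v(3) using i v(1) by (simp add: norm_mult)
  also have "(?B *\<^sub>v v) $ i = (\<Sum>j<n. of_real (A $$ (i, j)) * v $ j)"
    using i v(1) A by (simp add: scalar_prod_def lessThan_atLeast0)
  also have "norm \<dots> \<le> (\<Sum>j<n. A $$ (i, j) * norm (v $ j))"
    using i nonneg by (intro order.trans[OF norm_sum] sum_mono) (auto simp: norm_mult)
  also have "\<dots> \<le> (\<Sum>j<n. A $$ (i, j) * (M * x j))"
    using i nonneg M by (intro sum_mono mult_left_mono) auto
  also have "\<dots> = M * (\<Sum>j<n. A $$ (i, j) * x j)" by (simp add: sum_distrib_left mult_ac)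
  also have "\<dots> \<le> M * (\<rho> * x i)" using le[OF i(1)] \<open>M > 0\<close> by simp
  also have "\<dots> = \<rho> * norm (v $ i)" using i pos[OF i(1)] by simp
  finally have "norm k * norm (v $ i) \<le> \<rho> * norm (v $ i)" .
  moreover have "norm (v $ i) > 0" using i \<open>M > 0\<close> pos[OF i(1)] by (auto simp: zero_less_divide_iff)
  ultimately show ?thesis using k(2) by simp
qed

section \<open>The bounds in terms of vertices and out-neighbours\<close>

context fin_digraph
begin

text \<open>Translates matrix rows into sums over out-neighbours, so that test vectors can be
  functions on vertices, independent of the enumeration.\<close>

lemma A_alpha_row_sum:
  assumes "distinct vs" "set vs = verts G" "i < length vs"
  shows "(\<Sum>j<length vs. A_alpha \<alpha> G vs $$ (i, j) * x (vs ! j)) =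
    \<alpha> * real (out_degree G (vs ! i)) * x (vs ! i) + (1 - \<alpha>) * (\<Sum>w | vs ! i \<rightarrow>\<^bsub>G\<^esub> w. x w)"
proof -
  let ?u = "vs ! i"
  define f where "f w = \<alpha> * (if ?u = w then real (out_degree G ?u) else 0)
    + (1 - \<alpha>) * (if ?u \<rightarrow>\<^bsub>G\<^esub> w then 1 else 0)" for w
  have u: "?u \<in> verts G" using assms nth_mem by blast
  have bij: "bij_betw (\<lambda>j. vs ! j) {..<length vs} (verts G)"
    using assms by (intro bij_betw_nth) auto
  have "(\<Sum>j<length vs. A_alpha \<alpha> G vs $$ (i, j) * x (vs ! j)) =
      (\<Sum>j<length vs. f (vs ! j) * x (vs ! j))"
    using assms by (intro sum.cong)
      (auto simp: A_alpha_def adjacency_mat_def outdegree_mat_def f_def nth_eq_iff_index_eq)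
  also have "\<dots> = (\<Sum>w\<in>verts G. f w * x w)"
    by (rule sum.reindex_bij_betw[OF bij])
  also have "\<dots> = (\<Sum>w\<in>verts G. if ?u = w then \<alpha> * real (out_degree G ?u) * x w else 0)
      + (1 - \<alpha>) * (\<Sum>w\<in>verts G. if ?u \<rightarrow>\<^bsub>G\<^esub> w then x w else 0)"
    unfolding sum_distrib_left sum.distrib[symmetric]
    by (intro sum.cong) (auto simp: f_def algebra_simps)
  also have "(\<Sum>w\<in>verts G. if ?u = w then \<alpha> * real (out_degree G ?u) * x w else 0)
      = \<alpha> * real (out_degree G ?u) * x ?u"
    using u by simp
  also have "(\<Sum>w\<in>verts G. if ?u \<rightarrow>\<^bsub>G\<^esub> w then x w else 0) = (\<Sum>w | ?u \<rightarrow>\<^bsub>G\<^esub> w. x w)"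
    by (subst sum.inter_filter[symmetric]) (auto intro: sum.cong adj_in_verts)
  finally show ?thesis .
qed

lemma vertex_enum_props: "distinct (vertex_enum G)" "set (vertex_enum G) = verts G"
proof -
  have "\<exists>vs. distinct vs \<and> set vs = verts G" using finite_distinct_list[OF finite_verts] by blast
  then have "distinct (vertex_enum G) \<and> set (vertex_enum G) = verts G"
    unfolding vertex_enum_def by (rule someI_ex)
  then show "distinct (vertex_enum G)" "set (vertex_enum G) = verts G" by auto
qed

lemma A_alpha_nonneg:
  assumes "0 \<le> \<alpha>" "\<alpha> \<le> 1" "i < length vs" "j < length vs"
  shows "0 \<le> A_alpha \<alpha> G vs $$ (i, j)"
  using assms by (simp add: A_alpha_def adjacency_mat_def outdegree_mat_def)

lemma lambda_alpha_greaterI: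
  assumes "0 \<le> \<alpha>" "\<alpha> \<le> 1" "verts G \<noteq> {}" "0 < \<rho>"
    and pos: "\<And>u. u \<in> verts G \<Longrightarrow> 0 < x u"
    and gt: "\<And>u. u \<in> verts G \<Longrightarrow>
      \<rho> * x u < \<alpha> * real (out_degree G u) * x u + (1 - \<alpha>) * (\<Sum>w | u \<rightarrow>\<^bsub>G\<^esub> w. x w)"
  shows "\<rho> < lambda_alpha \<alpha> G"
  unfolding lambda_alpha_def
proof (rule spectral_radius_greaterI[where x = "\<lambda>i. x (vertex_enum G ! i)" and n = "length (vertex_enum G)"])
  show "\<rho> * x (vertex_enum G ! i) <
    (\<Sum>j<length (vertex_enum G). A_alpha \<alpha> G (vertex_enum G) $$ (i, j) * x (vertex_enum G ! j))"
    if "i < length (vertex_enum G)" for i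
    using gt[of "vertex_enum G ! i"] that vertex_enum_props nth_mem[OF that]
    by (simp add: A_alpha_row_sum)
  show "0 < x (vertex_enum G ! i)" if "i < length (vertex_enum G)" for i
    using pos nth_mem[OF that] vertex_enum_props by simp
qed (use assms vertex_enum_props A_alpha_nonneg in
  \<open>auto simp: A_alpha_def adjacency_mat_def outdegree_mat_def\<close>)

lemma lambda_alpha_leI:
  assumes "0 \<le> \<alpha>" "\<alpha> \<le> 1" "verts G \<noteq> {}"
    and pos: "\<And>u. u \<in> verts G \<Longrightarrow> 0 < x u"
    and le: "\<And>u. u \<in> verts G \<Longrightarrow>
      \<alpha> * real (out_degree G u) * x u + (1 - \<alpha>) * (\<Sum>w | u \<rightarrow>\<^bsub>G\<^esub> w. x w) \<le> \<rho> * x u"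
  shows "lambda_alpha \<alpha> G \<le> \<rho>"
  unfolding lambda_alpha_def
proof (rule spectral_radius_leI[where x = "\<lambda>i. x (vertex_enum G ! i)" and n = "length (vertex_enum G)"])
  show "(\<Sum>j<length (vertex_enum G). A_alpha \<alpha> G (vertex_enum G) $$ (i, j) * x (vertex_enum G ! j))
    \<le> \<rho> * x (vertex_enum G ! i)"
    if "i < length (vertex_enum G)" for i
    using le[of "vertex_enum G ! i"] that vertex_enum_props nth_mem[OF that]
    by (simp add: A_alpha_row_sum)
  show "0 < x (vertex_enum G ! i)" if "i < length (vertex_enum G)" for i
    using pos nth_mem[OF that] vertex_enum_props by simp
qed (use assms vertex_enum_props A_alpha_nonneg in
  \<open>auto simp: A_alpha_def adjacency_mat_def outdegree_mat_def\<close>)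

end

lemma (in nomulti_digraph) card_out_neighbours: "card {w. u \<rightarrow>\<^bsub>G\<^esub> w} = out_degree G u"
proof -
  have "{w. u \<rightarrow>\<^bsub>G\<^esub> w} = head G ` out_arcs G u"
    by (auto simp: arcs_ends_conv)
  moreover have "inj_on (head G) (out_arcs G u)"
    by (rule inj_onI) (auto intro: no_multi_arcs simp: arc_to_ends_def)
  ultimately show ?thesis by (simp add: out_degree_def card_image)
qed

lemma (in fin_digraph) finite_out_neighbours: "finite {w. u \<rightarrow>\<^bsub>G\<^esub> w}"
  by (rule finite_subset[OF _ finite_verts]) (auto intro: adj_in_verts)

lemma (in fin_digraph) sum_out_degree: "(\<Sum>u\<in>verts G. out_degree G u) = card (arcs G)"
proof -
  have "arcs G = (\<Union>u\<in>verts G. out_arcs G u)" by auto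
  moreover have "card (\<Union>u\<in>verts G. out_arcs G u) = (\<Sum>u\<in>verts G. card (out_arcs G u))"
    by (intro card_UN_disjoint) auto
  ultimately show ?thesis by (simp add: out_degree_def)
qed

section \<open>Directed distance in strongly connected digraphs\<close>

text \<open>The directed distance. If no walk leads from \<open>u\<close> to \<open>v\<close>, the
  value is unspecified; strong connectivity excludes this for vertices.\<close>

definition (in pre_digraph) hops :: "'a \<Rightarrow> 'a \<Rightarrow> nat" where
  "hops u v = (LEAST k. (u, v) \<in> arcs_ends G ^^ k)"

locale strongly_connected_digraph = digraph +
  assumes strongly_connected: "strongly_connected G"
begin

lemma relpow_hops:
  assumes "u \<in> verts G" "v \<in> verts G"
  shows "(u, v) \<in> arcs_ends G ^^ hops u v"
proof -
  have "(u, v) \<in> (arcs_ends G)\<^sup>*"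
    using strongly_connected assms by (auto simp: strongly_connected_def intro: reachable_rtranclI)
  then have "\<exists>k. (u, v) \<in> arcs_ends G ^^ k" by (rule rtrancl_imp_relpow)
  then show ?thesis unfolding hops_def by (rule LeastI_ex)
qed

lemma hops_le: "(u, v) \<in> arcs_ends G ^^ k \<Longrightarrow> hops u v \<le> k"
  unfolding hops_def by (rule Least_le)

lemma hops_refl [simp]: "hops v v = 0"
  using hops_le[of v v 0] by simp

lemma hops_eq_0_iff: "u \<in> verts G \<Longrightarrow> v \<in> verts G \<Longrightarrow> hops u v = 0 \<longleftrightarrow> u = v"
  using relpow_hops[of u v] by auto

lemma hops_adj_le:
  assumes "u \<rightarrow>\<^bsub>G\<^esub> w" "v \<in> verts G"
  shows "hops u v \<le> Suc (hops w v)"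
  using assms by (intro hops_le relpow_Suc_I2[OF _ relpow_hops]) (auto intro: adj_in_verts)

lemma hops_next:
  assumes "u \<in> verts G" "v \<in> verts G" "u \<noteq> v"
  obtains w where "u \<rightarrow>\<^bsub>G\<^esub> w" "hops u v = Suc (hops w v)"
proof -
  have "hops u v \<noteq> 0" using assms by (simp add: hops_eq_0_iff)
  then obtain k where k: "hops u v = Suc k" by (auto simp: gr0_conv_Suc)
  with relpow_hops[OF assms(1,2)] obtain w where w: "u \<rightarrow>\<^bsub>G\<^esub> w" "(w, v) \<in> arcs_ends G ^^ k"
    using relpow_Suc_D2 by metis
  from hops_le[OF w(2)] hops_adj_le[OF w(1) assms(2)] k have "hops u v = Suc (hops w v)" by simp
  with w(1) show ?thesis by (rule that)
qed

text \<open>Along a shortest path the distance to \<open>v\<close> drops by exactly one per arc, so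
  the path meets level \<open>j\<close>, and it does so after \<open>hops u v - j\<close>
  arcs.\<close>

lemma hops_level:
  assumes "u \<in> verts G" "v \<in> verts G" "j \<le> hops u v"
  obtains w where "w \<in> verts G" "hops w v = j" "hops u w \<le> hops u v - j"
proof -
  have "\<exists>w\<in>verts G. hops w v = j \<and> hops u w \<le> hops u v - j"
    using assms(1,3)
  proof (induction "hops u v" arbitrary: u)
    case 0
    then show ?case by (auto intro!: bexI[of _ u])
  next
    case (Suc k)
    show ?case
    proof (cases "j = Suc k")
      case True
      then show ?thesis using Suc by (auto intro!: bexI[of _ u])
    next
      case False
      have "u \<noteq> v" using Suc.hyps(2) by auto
      then obtain u' where u': "u \<rightarrow>\<^bsub>G\<^esub> u'" "hops u v = Suc (hops u' v)"
        using hops_next Suc.prems(1) assms(2) by blast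
      have "k = hops u' v" "u' \<in> verts G" "j \<le> hops u' v"
        using Suc u' False by (auto intro: adj_in_verts)
      from Suc.hyps(1)[OF this] obtain w
        where w: "w \<in> verts G" "hops w v = j" "hops u' w \<le> hops u' v - j" by blast
      have "hops u w \<le> hops u v - j"
        using hops_adj_le[OF u'(1) w(1)] w(3) u'(2) \<open>j \<le> hops u' v\<close> by simp
      with w show ?thesis by blast
    qed
  qed
  with that show ?thesis by blast
qed

text \<open>Each of the levels \<open>0\<close> to \<open>hops u v\<close> contains a vertex by
  \<open>hops_level\<close>, and different levels contain different vertices.\<close>

lemma hops_less_card:
  assumes "u \<in> verts G" "v \<in> verts G"
  shows "hops u v < card (verts G)"
proof -
  have "{..hops u v} \<subseteq> (\<lambda>w. hops w v) ` verts G"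
  proof
    fix j assume "j \<in> {..hops u v}"
    then obtain w where "w \<in> verts G" "hops w v = j" using hops_level[OF assms, of j] by auto
    then show "j \<in> (\<lambda>w. hops w v) ` verts G" by auto
  qed
  then have "card {..hops u v} \<le> card ((\<lambda>w. hops w v) ` verts G)" by (intro card_mono) auto
  also have "\<dots> \<le> card (verts G)" by (rule card_image_le) simp
  finally show ?thesis by simp
qed

section \<open>Strict lower bounds from test vectors\<close>

text \<open>Strong connectivity spreads the slack at \<open>r\<close> over all vertices: add \<open>\<epsilon>\<close> to the power
  \<open>hops u r + 1\<close> to the entry at \<open>u\<close>.\<close>

lemma lambda_alpha_greater_subinvariant:
  assumes \<alpha>: "0 \<le> \<alpha>" "\<alpha> < 1" and \<rho>: "0 < \<rho>"
    and pos: "\<And>u. u \<in> verts G \<Longrightarrow> 0 < x u"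
    and ge: "\<And>u. u \<in> verts G \<Longrightarrow>
      \<rho> * x u \<le> \<alpha> * real (out_degree G u) * x u + (1 - \<alpha>) * (\<Sum>w | u \<rightarrow>\<^bsub>G\<^esub> w. x w)"
    and r: "r \<in> verts G"
    and gt: "\<rho> * x r < \<alpha> * real (out_degree G r) * x r + (1 - \<alpha>) * (\<Sum>w | r \<rightarrow>\<^bsub>G\<^esub> w. x w)"
  shows "\<rho> < lambda_alpha \<alpha> G"
proof -
  \<comment> \<open>The second argument of \<open>min\<close> keeps the perturbation below the slack
    at \<open>r\<close>. The first makes \<open>\<rho> * y u\<close> smaller than the gain
    \<open>(1 - \<alpha>) * y v\<close> from the next vertex \<open>v\<close> towards
    \<open>r\<close>.\<close>
  define \<eta> where "\<eta> = min (1 - \<alpha>)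
    (\<alpha> * real (out_degree G r) * x r + (1 - \<alpha>) * (\<Sum>w | r \<rightarrow>\<^bsub>G\<^esub> w. x w) - \<rho> * x r)"
  define \<epsilon> where "\<epsilon> = \<eta> / (2 * \<rho>)"
  have "\<eta> > 0" using gt \<alpha> by (simp add: \<eta>_def)
  then have \<epsilon>: "\<epsilon> > 0" "\<rho> * \<epsilon> < \<eta>" using \<rho> by (auto simp: \<epsilon>_def)
  define y where "y u = \<epsilon> ^ Suc (hops u r)" for u
  have y: "y u > 0" for u using \<epsilon> by (simp add: y_def)
  have sum_y: "0 \<le> (\<Sum>w | u \<rightarrow>\<^bsub>G\<^esub> w. y w)" for u using y by (intro sum_nonneg) (auto simp: less_imp_le)
  have deg_y: "0 \<le> \<alpha> * real (out_degree G u) * y u" for u using \<alpha> y[of u] by simp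
  show ?thesis
  proof (rule lambda_alpha_greaterI[where x = "\<lambda>u. x u + y u"])
    fix u assume u: "u \<in> verts G"
    show "0 < x u + y u" using pos[OF u] y[of u] by simp
    have "\<rho> * x u + \<rho> * y u < \<alpha> * real (out_degree G u) * x u + (1 - \<alpha>) * (\<Sum>w | u \<rightarrow>\<^bsub>G\<^esub> w. x w)
        + (1 - \<alpha>) * (\<Sum>w | u \<rightarrow>\<^bsub>G\<^esub> w. y w)"
    proof (cases "u = r")
      case True
      have "\<rho> * y r < \<eta>" using \<epsilon> by (simp add: y_def)
      then have "\<rho> * x r + \<rho> * y r <
        \<alpha> * real (out_degree G r) * x r + (1 - \<alpha>) * (\<Sum>w | r \<rightarrow>\<^bsub>G\<^esub> w. x w)"
        unfolding \<eta>_def by simp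
      moreover have "0 \<le> (1 - \<alpha>) * (\<Sum>w | r \<rightarrow>\<^bsub>G\<^esub> w. y w)" using sum_y \<alpha> by simp
      ultimately show ?thesis unfolding True by linarith
    next
      case False
      then obtain v where v: "u \<rightarrow>\<^bsub>G\<^esub> v" "hops u r = Suc (hops v r)" using hops_next u r by blast
      have "\<rho> * \<epsilon> < 1 - \<alpha>" using \<epsilon> by (simp add: \<eta>_def)
      then have "\<rho> * \<epsilon> * y v < (1 - \<alpha>) * y v" using y by simp
      moreover have "\<rho> * \<epsilon> * y v = \<rho> * y u" using v by (simp add: y_def)
      moreover have "y v \<le> (\<Sum>w | u \<rightarrow>\<^bsub>G\<^esub> w. y w)"
        using v y finite_out_neighbours by (intro member_le_sum) (auto simp: less_imp_le)
      then have "(1 - \<alpha>) * y v \<le> (1 - \<alpha>) * (\<Sum>w | u \<rightarrow>\<^bsub>G\<^esub> w. y w)" using \<alpha> by simp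
      ultimately show ?thesis using ge[OF u] by linarith
    qed
    then show "\<rho> * (x u + y u) < \<alpha> * real (out_degree G u) * (x u + y u)
        + (1 - \<alpha>) * (\<Sum>w | u \<rightarrow>\<^bsub>G\<^esub> w. x w + y w)"
      using deg_y[of u] by (simp add: sum.distrib distrib_left)
  qed (use \<alpha> \<rho> r in auto)
qed

text \<open>With \<open>\<rho> = \<alpha> + (1 - \<alpha>) t\<close>, a vertex with \<open>d\<close> out-neighbours satisfies the eigenvalue
  inequality iff their entries sum to at least \<open>t - (d - 1) \<alpha> / (1 - \<alpha>)\<close> times its own.\<close>

lemma lambda_alpha_greater_test_vector:
  assumes \<alpha>: "0 \<le> \<alpha>" "\<alpha> < 1" and t: "0 < t"
    and pos: "\<And>u. u \<in> verts G \<Longrightarrow> 0 < x u"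
    and N: "\<And>u. u \<in> verts G \<Longrightarrow> N u \<subseteq> {w. u \<rightarrow>\<^bsub>G\<^esub> w}"
    and ge: "\<And>u. u \<in> verts G \<Longrightarrow> (t - \<alpha> / (1 - \<alpha>) * (real (card (N u)) - 1)) * x u \<le> sum x (N u)"
    and r: "r \<in> verts G"
    and gt: "(t - \<alpha> / (1 - \<alpha>) * (real (card (N r)) - 1)) * x r < sum x (N r) \<or> N r \<noteq> {w. r \<rightarrow>\<^bsub>G\<^esub> w}"
  shows "\<alpha> + (1 - \<alpha>) * t < lambda_alpha \<alpha> G"
proof -
  \<comment> \<open>Out-neighbours outside \<open>N u\<close> can only help in the degree term,
    because \<open>card (N u)\<close> is at most the outdegree.\<close>
  have row: "(\<alpha> + (1 - \<alpha>) * t) * x u + (1 - \<alpha>) *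
      ((\<Sum>w | u \<rightarrow>\<^bsub>G\<^esub> w. x w) - (t - \<alpha> / (1 - \<alpha>) * (real (card (N u)) - 1)) * x u)
      \<le> \<alpha> * real (out_degree G u) * x u + (1 - \<alpha>) * (\<Sum>w | u \<rightarrow>\<^bsub>G\<^esub> w. x w)"
    if u: "u \<in> verts G" for u
  proof -
    have "card (N u) \<le> out_degree G u"
      unfolding card_out_neighbours[symmetric] using N[OF u] finite_out_neighbours by (rule card_mono[rotated])
    then have "\<alpha> * real (card (N u)) * x u \<le> \<alpha> * real (out_degree G u) * x u"
      using \<alpha> pos[OF u] by (intro mult_right_mono mult_left_mono) auto
    moreover have "(1 - \<alpha>) * ((t - \<alpha> / (1 - \<alpha>) * (real (card (N u)) - 1)) * x u)
        = ((1 - \<alpha>) * t - \<alpha> * (real (card (N u)) - 1)) * x u"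
      using \<alpha> by (simp add: field_simps)
    ultimately show ?thesis by (simp add: algebra_simps)
  qed
  have sum_le: "sum x (N u) \<le> (\<Sum>w | u \<rightarrow>\<^bsub>G\<^esub> w. x w)" if "u \<in> verts G" for u
    using N[OF that] finite_out_neighbours pos adj_in_verts by (intro sum_mono2) (auto simp: less_imp_le)
  have sum_less: "sum x (N u) < (\<Sum>w | u \<rightarrow>\<^bsub>G\<^esub> w. x w)"
    if u: "u \<in> verts G" and ne: "N u \<noteq> {w. u \<rightarrow>\<^bsub>G\<^esub> w}" for u
  proof -
    obtain w where w: "u \<rightarrow>\<^bsub>G\<^esub> w" "w \<notin> N u" using N[OF u] ne by blast
    show ?thesis
      using N[OF u] finite_out_neighbours pos adj_in_verts w
      by (intro sum_strict_mono2[of _ _ w]) (auto simp: less_imp_le)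
  qed
  show ?thesis
  proof (rule lambda_alpha_greater_subinvariant[where x = x and r = r])
    show "0 < \<alpha> + (1 - \<alpha>) * t" using \<alpha> t by (simp add: add_nonneg_pos)
    show "(\<alpha> + (1 - \<alpha>) * t) * x u \<le>
      \<alpha> * real (out_degree G u) * x u + (1 - \<alpha>) * (\<Sum>w | u \<rightarrow>\<^bsub>G\<^esub> w. x w)" if u: "u \<in> verts G" for u
    proof -
      have "0 \<le> (1 - \<alpha>) *
        ((\<Sum>w | u \<rightarrow>\<^bsub>G\<^esub> w. x w) - (t - \<alpha> / (1 - \<alpha>) * (real (card (N u)) - 1)) * x u)"
        using ge[OF u] sum_le[OF u] \<alpha> by simp
      with row[OF u] show ?thesis by linarith
    qed
    have "(t - \<alpha> / (1 - \<alpha>) * (real (card (N r)) - 1)) * x r < (\<Sum>w | r \<rightarrow>\<^bsub>G\<^esub> w. x w)"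
      using gt ge[OF r] sum_le[OF r] sum_less[OF r] by fastforce
    then have "0 < (1 - \<alpha>) *
        ((\<Sum>w | r \<rightarrow>\<^bsub>G\<^esub> w. x w) - (t - \<alpha> / (1 - \<alpha>) * (real (card (N r)) - 1)) * x r)"
      using \<alpha> by simp
    with row[OF r] show "(\<alpha> + (1 - \<alpha>) * t) * x r <
      \<alpha> * real (out_degree G r) * x r + (1 - \<alpha>) * (\<Sum>w | r \<rightarrow>\<^bsub>G\<^esub> w. x w)" by linarith
  qed (use \<alpha> pos r in auto)
qed

lemma lambda_alpha_greater_short_cycle:
  assumes \<alpha>: "0 \<le> \<alpha>" "\<alpha> < 1" and t: "1 < t"
    and eq: "(t - \<alpha> / (1 - \<alpha>)) * t ^ (card (verts G) - 1) = t ^ 2 + 1"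
    and v: "v \<rightarrow>\<^bsub>G\<^esub> w1" "v \<rightarrow>\<^bsub>G\<^esub> w2" "w1 \<noteq> w2" and short: "hops w1 v + 3 \<le> card (verts G)"
    and arcs: "card (arcs G) \<ge> card (verts G) + 2"
  shows "\<alpha> + (1 - \<alpha>) * t < lambda_alpha \<alpha> G"
proof -
  define n where "n = card (verts G)"
  have vV: "v \<in> verts G" using v adj_in_verts by blast
  have "\<forall>u. \<exists>w. u \<in> verts G - {v} \<longrightarrow> u \<rightarrow>\<^bsub>G\<^esub> w \<and> hops u v = Suc (hops w v)"
    using hops_next vV by blast
  then obtain nxt where nxt: "\<And>u. u \<in> verts G \<Longrightarrow> u \<noteq> v \<Longrightarrow> u \<rightarrow>\<^bsub>G\<^esub> nxt u \<and> hops u v = Suc (hops (nxt u) v)"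
    by (metis Diff_iff empty_iff insert_iff)
  define N where "N u = (if u = v then {w1, w2} else {nxt u})" for u
  define x where "x u = t ^ (n - 1 - hops u v)" for u
  \<comment> \<open>\<open>N\<close> selects \<open>2 + (n - 1)\<close> arcs, one fewer than
    \<open>G\<close> is known to have, so some selection is proper.\<close>
  have "\<exists>r\<in>verts G. N r \<noteq> {w. r \<rightarrow>\<^bsub>G\<^esub> w}"
  proof (rule ccontr)
    assume "\<not> ?thesis"
    then have "out_degree G u = card (N u)" if "u \<in> verts G" for u
      using that by (simp add: card_out_neighbours[symmetric])
    then have "card (arcs G) = (\<Sum>u\<in>verts G. card (N u))" by (simp add: sum_out_degree[symmetric])
    also have "\<dots> = card (N v) + (\<Sum>u\<in>verts G - {v}. card (N u))"
      using vV by (simp add: sum.remove)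
    also have "(\<Sum>u\<in>verts G - {v}. card (N u)) = (\<Sum>u\<in>verts G - {v}. 1)"
      by (intro sum.cong) (auto simp: N_def)
    finally have "card (arcs G) = 2 + (card (verts G) - 1)" using v vV by (simp add: N_def)
    with arcs short show False by simp
  qed
  then obtain r where r: "r \<in> verts G" "N r \<noteq> {w. r \<rightarrow>\<^bsub>G\<^esub> w}" by blast
  show ?thesis
  proof (rule lambda_alpha_greater_test_vector[where x = x and N = N and r = r])
    fix u assume u: "u \<in> verts G"
    show "0 < x u" using t by (simp add: x_def)
    show "N u \<subseteq> {w. u \<rightarrow>\<^bsub>G\<^esub> w}" using u nxt v by (auto simp: N_def)
    show "(t - \<alpha> / (1 - \<alpha>) * (real (card (N u)) - 1)) * x u \<le> sum x (N u)"
    proof (cases "u = v")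
      case True
      \<comment> \<open>Distance at most \<open>n - 3\<close> for \<open>w1\<close> gives the
        summand \<open>t ^ 2\<close> in \<open>eq\<close>; the weakest bound on the entry at
        \<open>w2\<close> gives the summand 1.\<close>
      have "t ^ 2 \<le> x w1" unfolding x_def using t short by (intro power_increasing) (auto simp: n_def)
      moreover have "1 \<le> x w2" unfolding x_def using t by simp
      ultimately show ?thesis using True v eq by (simp add: N_def x_def n_def)
    next
      case False
      \<comment> \<open>Distances are at most \<open>n - 1\<close>, so the subtraction is not
        truncated and one arc towards \<open>v\<close> multiplies the entry by
        \<open>t\<close>.\<close>
      have "n - 1 - hops (nxt u) v = Suc (n - 1 - hops u v)"
        using nxt[OF u False] hops_less_card[OF u vV] by (simp add: n_def)
      then show ?thesis using False by (simp add: N_def x_def)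
    qed
  qed (use \<alpha> t r in auto)
qed

text \<open>The plain distance vector \<open>p\<close> can fail at \<open>a\<close>, because
  \<open>b\<close> may be too far away. The second pair of out-neighbours, at \<open>b\<close>,
  allows a larger entry at \<open>b\<close>, namely the one making the selected row inequality at
  \<open>b\<close> an equality. All other entries stay fixed, so the rows of the remaining vertices
  only improve.\<close>

lemma lambda_alpha_greater_adjacent_chords:
  assumes \<alpha>: "0 \<le> \<alpha>" "\<alpha> < 1" and t: "1 < t" "t < 2" "\<alpha> / (1 - \<alpha>) < t"
    and eq: "(t - \<alpha> / (1 - \<alpha>)) * t ^ (card (verts G) - 1) = t ^ 2 + 1"
    and adj: "a \<rightarrow>\<^bsub>G\<^esub> b" "a \<rightarrow>\<^bsub>G\<^esub> c" "b \<rightarrow>\<^bsub>G\<^esub> c" "b \<rightarrow>\<^bsub>G\<^esub> d" "c \<noteq> d"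
    and hops: "card (verts G) \<le> hops b a + 2" "hops c a + 2 \<le> card (verts G)"
      "hops d a + 3 \<le> card (verts G)"
  shows "\<alpha> + (1 - \<alpha>) * t < lambda_alpha \<alpha> G"
proof -
  define n where "n = card (verts G)"
  define T where "T = t - \<alpha> / (1 - \<alpha>)"
  have T: "0 < T" "T \<le> t" using t \<alpha> by (auto simp: T_def)
  have V: "a \<in> verts G" "b \<in> verts G" using adj adj_in_verts by blast+
  have ne: "a \<noteq> b" "b \<noteq> c" "b \<noteq> d" using adj adj_not_same by blast+
  have "\<forall>u. \<exists>w. u \<in> verts G - {a} \<longrightarrow> u \<rightarrow>\<^bsub>G\<^esub> w \<and> hops u a = Suc (hops w a)"
    using hops_next V by blast
  then obtain nxt where nxt: "\<And>u. u \<in> verts G \<Longrightarrow> u \<noteq> a \<Longrightarrow> u \<rightarrow>\<^bsub>G\<^esub> nxt u \<and> hops u a = Suc (hops (nxt u) a)"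
    by (metis Diff_iff empty_iff insert_iff)
  define N where "N u = (if u = a then {b, c} else if u = b then {c, d} else {nxt u})" for u
  define p where "p u = t ^ (n - 1 - hops u a)" for u
  define x where "x u = (if u = b then (p c + p d) / T else p u)" for u
  have pc: "t \<le> p c" unfolding p_def using t hops power_increasing[of 1 "n - 1 - hops c a" t]
    by (simp add: n_def)
  have pd: "t ^ 2 \<le> p d" unfolding p_def using t hops by (intro power_increasing) (auto simp: n_def)
  have xb: "1 + t \<le> x b"
  proof -
    \<comment> \<open>The numerator collects the lower bounds for \<open>p c\<close> and
      \<open>p d\<close>, and \<open>T\<close> is at most \<open>t\<close>.\<close>
    have "1 + t = (t + t ^ 2) / t" using t by (simp add: field_simps power2_eq_square)
    also have "\<dots> \<le> (p c + p d) / T" using T pc pd t by (intro frac_le add_mono add_nonneg_nonneg) (auto simp: p_def)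
    finally show ?thesis by (simp add: x_def)
  qed
  have "n - 1 - hops b a \<le> 1" using hops by (simp add: n_def)
  then have "p b \<le> t ^ 1" unfolding p_def using t by (intro power_increasing) auto
  then have px: "p u \<le> x u" for u using xb by (auto simp: x_def)
  have "0 < p u" for u using t by (simp add: p_def)
  then have pos: "0 < x u" for u using px[of u] less_le_trans by blast
  \<comment> \<open>Row \<open>a\<close> asks for more than \<open>T * x a = t ^ 2 + 1\<close>,
    while \<open>x b + x c\<close> is at least \<open>(1 + t) + t\<close>; this is where
    \<open>t < 2\<close> enters.\<close>
  have "t * t < 2 * t" using t by (intro mult_strict_right_mono) auto
  then have "T * x a < x b + x c"
    using xb pc ne adj eq adj_not_same by (auto simp: x_def p_def n_def T_def power2_eq_square)
  then have strict: "(t - \<alpha> / (1 - \<alpha>) * (real (card (N a)) - 1)) * x a < sum x (N a)"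
    using ne by (simp add: N_def T_def)
  show ?thesis
  proof (rule lambda_alpha_greater_test_vector[where x = x and N = N and r = a])
    fix u assume u: "u \<in> verts G"
    show "N u \<subseteq> {w. u \<rightarrow>\<^bsub>G\<^esub> w}" using u nxt adj by (auto simp: N_def)
    consider "u = a" | "u = b" | "u \<noteq> a" "u \<noteq> b" by blast
    then show "(t - \<alpha> / (1 - \<alpha>) * (real (card (N u)) - 1)) * x u \<le> sum x (N u)"
    proof cases
      case 1
      then show ?thesis using strict by simp
    next
      case 2
      have "T * x b = p c + p d" using T by (simp add: x_def)
      moreover have "x c = p c" "x d = p d" using ne by (auto simp: x_def)
      ultimately show ?thesis using 2 ne adj by (simp add: N_def T_def)
    next
      case 3
      have "n - 1 - hops (nxt u) a = Suc (n - 1 - hops u a)"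
        using nxt[OF u 3(1)] hops_less_card[OF u V(1)] by (simp add: n_def)
      then have "t * x u = p (nxt u)" using 3 by (simp add: x_def p_def)
      then show ?thesis using 3 px[of "nxt u"] by (simp add: N_def)
    qed
  qed (use \<alpha> t V pos strict in auto)
qed

section \<open>Structure of the digraphs without a short cycle through a branching vertex\<close>

text \<open>If the first alternative fails, every out-neighbour of a branching vertex
  \<open>v\<close> is at distance at least \<open>n - 2\<close> from \<open>v\<close>. Then the
  vertices other than two out-neighbours of \<open>v\<close> form a ladder, one per distance level.
  The arc count yields a second branching vertex \<open>z\<close>; wherever it sits, it is pinned
  down far enough to give the chords.\<close>

lemma short_cycle_or_adjacent_chords:
  assumes n: "5 \<le> card (verts G)" and arcs: "card (arcs G) \<ge> card (verts G) + 2"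
  obtains (short_cycle) v w1 w2 where "v \<rightarrow>\<^bsub>G\<^esub> w1" "v \<rightarrow>\<^bsub>G\<^esub> w2" "w1 \<noteq> w2" "hops w1 v + 3 \<le> card (verts G)"
  | (adjacent_chords) a b c d where "a \<rightarrow>\<^bsub>G\<^esub> b" "a \<rightarrow>\<^bsub>G\<^esub> c" "b \<rightarrow>\<^bsub>G\<^esub> c" "b \<rightarrow>\<^bsub>G\<^esub> d" "c \<noteq> d"
      "card (verts G) \<le> hops b a + 2" "hops c a + 2 \<le> card (verts G)"
      "hops d a + 3 \<le> card (verts G)"
proof (cases "\<exists>v w1 w2. v \<rightarrow>\<^bsub>G\<^esub> w1 \<and> v \<rightarrow>\<^bsub>G\<^esub> w2 \<and> w1 \<noteq> w2 \<and> hops w1 v + 3 \<le> card (verts G)")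
  case True
  then show ?thesis using short_cycle by blast
next
  case False
  define n where "n = card (verts G)"
  have n5: "5 \<le> n" using n by (simp add: n_def)
  have long: "n \<le> hops w1 v + 2" if "v \<rightarrow>\<^bsub>G\<^esub> w1" "v \<rightarrow>\<^bsub>G\<^esub> w2" "w1 \<noteq> w2" for v w1 w2
  proof (rule ccontr)
    assume "\<not> ?thesis"
    then have "hops w1 v + 3 \<le> card (verts G)" by (simp add: n_def)
    with False that show False by blast
  qed
  have two: "\<exists>w1 w2. u \<rightarrow>\<^bsub>G\<^esub> w1 \<and> u \<rightarrow>\<^bsub>G\<^esub> w2 \<and> w1 \<noteq> w2" if "2 \<le> out_degree G u" for u
  proof -
    have "2 \<le> card {w. u \<rightarrow>\<^bsub>G\<^esub> w}" using that by (simp add: card_out_neighbours)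
    then obtain S where "S \<subseteq> {w. u \<rightarrow>\<^bsub>G\<^esub> w}" "card S = 2" using obtain_subset_with_card_n by metis
    then show ?thesis by (auto simp: card_2_iff)
  qed
  have "\<exists>v\<in>verts G. 2 \<le> out_degree G v"
  proof (rule ccontr)
    assume "\<not> ?thesis"
    then have "(\<Sum>u\<in>verts G. out_degree G u) \<le> (\<Sum>u\<in>verts G. 1)" by (intro sum_mono) auto
    then show False using arcs by (simp add: sum_out_degree)
  qed
  then obtain v w1 w2 where vV: "v \<in> verts G" and v: "v \<rightarrow>\<^bsub>G\<^esub> w1" "v \<rightarrow>\<^bsub>G\<^esub> w2" "w1 \<noteq> w2"
    using two by blast
  define h where "h u = hops u v" for u
  define W where "W = verts G - {w1, w2}"
  have wV: "w1 \<in> verts G" "w2 \<in> verts G" using v adj_in_verts by blast+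
  have hw: "n \<le> h w1 + 2" "n \<le> h w2 + 2" using long v unfolding h_def by blast+
  have cardW: "card W = n - 2" unfolding W_def n_def using wV v by (subst card_Diff_subset) auto
  have finW: "finite W" by (simp add: W_def)
  \<comment> \<open>A shortest path from \<open>w1\<close> to \<open>v\<close> meets every level
    below \<open>n - 2\<close>, and \<open>w1\<close>, \<open>w2\<close> lie too high to be those
    vertices. By counting, \<open>W\<close> has exactly one vertex on each such level.\<close>
  have sub: "{..<n - 2} \<subseteq> h ` W"
  proof
    fix j assume j: "j \<in> {..<n - 2}"
    then have "j \<le> hops w1 v" using hw(1) by (simp add: h_def)
    then obtain w where w: "w \<in> verts G" "h w = j"
      using hops_level[OF wV(1) vV] unfolding h_def by blast
    then have "w \<in> W" using j hw by (auto simp: W_def)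
    with w show "j \<in> h ` W" by blast
  qed
  have "card (h ` W) = card W"
    using card_mono[OF _ sub] card_image_le[OF finW, of h] finW cardW by simp
  then have inj: "inj_on h W" using finW by (intro eq_card_imp_inj_on)
  have img: "h ` W = {..<n - 2}"
    using sub \<open>card (h ` W) = card W\<close> finW cardW by (intro card_subset_eq[symmetric]) auto
  have low: "h u < n - 2" if "u \<in> verts G" "u \<noteq> w1" "u \<noteq> w2" for u
    using that img by (auto simp: W_def)
  have unique: "u = w" if "u \<in> verts G" "w \<in> verts G" "h u = h w" "h u < n - 2" for u w
    using that hw by (intro inj_onD[OF inj]) (auto simp: W_def)
  have top: "h u < n" if "u \<in> verts G" for u
    using hops_less_card[OF that vV] by (simp add: h_def n_def)
  have step: "h u \<le> Suc (h w)" if "u \<rightarrow>\<^bsub>G\<^esub> w" for u w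
    using hops_adj_le[OF that vV] by (simp add: h_def)
  \<comment> \<open>A third out-neighbour would belong to the ladder, hence be closer to
    \<open>v\<close> than \<open>long\<close> permits.\<close>
  have "{w. v \<rightarrow>\<^bsub>G\<^esub> w} = {w1, w2}"
  proof -
    have "w = w1 \<or> w = w2" if w: "v \<rightarrow>\<^bsub>G\<^esub> w" for w
    proof (rule ccontr)
      assume "\<not> ?thesis"
      with w have "h w < n - 2" "n \<le> h w + 2"
        using low[of w] long[OF w v(1)] adj_in_verts[OF w] by (auto simp: h_def)
      then show False by simp
    qed
    with v show ?thesis by blast
  qed
  then have "out_degree G v = 2" using v card_out_neighbours[of v] by simp
  \<comment> \<open>Otherwise there would be at most \<open>2 + (n - 1)\<close> arcs.\<close>
  have "\<exists>z\<in>verts G - {v}. 2 \<le> out_degree G z"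
  proof (rule ccontr)
    assume none: "\<not> ?thesis"
    have "out_degree G u \<le> 1" if u: "u \<in> verts G - {v}" for u
    proof -
      have "\<not> 2 \<le> out_degree G u" using none u by blast
      then show ?thesis by simp
    qed
    then have "(\<Sum>u\<in>verts G - {v}. out_degree G u) \<le> (\<Sum>u\<in>verts G - {v}. 1)" by (rule sum_mono)
    moreover have "card (arcs G) = 2 + (\<Sum>u\<in>verts G - {v}. out_degree G u)"
      unfolding sum_out_degree[symmetric] using \<open>out_degree G v = 2\<close> vV by (simp add: sum.remove)
    ultimately show False using arcs vV n by simp
  qed
  then obtain z z1 z2 where z: "z \<in> verts G" "z \<noteq> v" and zz: "z \<rightarrow>\<^bsub>G\<^esub> z1" "z \<rightarrow>\<^bsub>G\<^esub> z2" "z1 \<noteq> z2"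
    using two by blast
  have hz: "h z \<noteq> 0" using z vV by (simp add: h_def hops_eq_0_iff)
  show ?thesis
  proof (cases "z = w1 \<or> z = w2")
    case False
    then have lowz: "h z < n - 2" using low z by blast
    \<comment> \<open>The only vertex on the level of \<open>z\<close> is \<open>z\<close> itself,
      and the level just below holds a single vertex, so two distinct out-neighbours cannot both
      avoid going up.\<close>
    have "h z < h z1 \<or> h z < h z2"
    proof (rule ccontr)
      assume "\<not> ?thesis"
      moreover have "h z \<noteq> h z1" "h z \<noteq> h z2"
        using unique[of z z1] unique[of z z2] lowz zz adj_in_verts adj_not_same by blast+
      ultimately have "h z1 = h z2" "h z1 < n - 2" using step[OF zz(1)] step[OF zz(2)] lowz by auto
      with unique zz adj_in_verts show False by blast
    qed
    then obtain c c' where c: "z \<rightarrow>\<^bsub>G\<^esub> c" "z \<rightarrow>\<^bsub>G\<^esub> c'" "c \<noteq> c'" "h z < h c" using zz by blast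
    have cV: "c \<in> verts G" using c adj_in_verts by blast
    \<comment> \<open>Since \<open>z\<close> is alone on its level, every shortest path to
      \<open>v\<close> from that level or above passes through \<open>z\<close>.\<close>
    have via_z: "hops u z \<le> h u - h z" if u: "u \<in> verts G" "h z \<le> h u" for u
    proof -
      obtain w where w: "w \<in> verts G" "h w = h z" "hops u w \<le> h u - h z"
        using hops_level[OF u(1) vV, of "h z"] u(2) unfolding h_def by blast
      with unique[of w z] z lowz show ?thesis by simp
    qed
    have "n \<le> hops c z + 2" using long c by blast
    \<comment> \<open>Here \<open>n - 2 \<le> hops c z \<le> h c - h z \<le> (n - 1) - 1\<close>, so
      equality holds throughout.\<close>
    with via_z[OF cV] c(4) top[OF cV] hz have hz1: "h z = 1" and hc: "h c = n - 1" by linarith+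
    have "z \<rightarrow>\<^bsub>G\<^esub> v"
    proof -
      obtain w where w: "z \<rightarrow>\<^bsub>G\<^esub> w" "h z = Suc (h w)" using hops_next[OF z(1) vV z(2)] unfolding h_def by blast
      then have "w = v" using hz1 vV adj_in_verts[OF w(1)] by (simp add: h_def hops_eq_0_iff)
      with w show ?thesis by simp
    qed
    have "n - 2 \<le> hops c v" using hc by (simp add: h_def)
    then obtain d where d: "d \<in> verts G" "h d = n - 2"
      using hops_level[OF cV vV] unfolding h_def by blast
    have "d \<noteq> c" using hc d n5 by auto
    moreover have "\<not> h c < n - 2" using hc by simp
    then have "d \<in> {w1, w2}" "c \<in> {w1, w2}" using low[of d] low[of c] d cV by auto
    ultimately have vcd: "v \<rightarrow>\<^bsub>G\<^esub> c" "v \<rightarrow>\<^bsub>G\<^esub> d" "c \<noteq> d" using v by auto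
    show ?thesis
    \<comment> \<open>The roles of \<open>a\<close> and \<open>b\<close> are played by
      \<open>z\<close> and \<open>v\<close>.\<close>
    proof (rule adjacent_chords[OF \<open>z \<rightarrow>\<^bsub>G\<^esub> v\<close> c(1) vcd])
      show "card (verts G) \<le> hops v z + 2"
        using long[OF \<open>z \<rightarrow>\<^bsub>G\<^esub> v\<close> c(1)] vcd(1) adj_not_same unfolding n_def by blast
      show "hops c z + 2 \<le> card (verts G)" using via_z[OF cV] hc hz1 n5 unfolding n_def by linarith
      show "hops d z + 3 \<le> card (verts G)" using via_z[OF d(1)] d(2) hz1 n5 unfolding n_def by linarith
    qed
  next
    case True
    then obtain c where c: "{z, c} = {w1, w2}" "z \<noteq> c" using v(3) by blast
    then have cV: "c \<in> verts G" and vzc: "v \<rightarrow>\<^bsub>G\<^esub> z" "v \<rightarrow>\<^bsub>G\<^esub> c" using wV v by (auto simp: doubleton_eq_iff)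
    have hzn: "n \<le> h z + 2" using True hw by auto
    have low': "h u < n - 2" if "u \<in> verts G" "u \<noteq> z" "u \<noteq> c" for u using low that c by blast
    \<comment> \<open>An arc lowers the level by at most one, \<open>z\<close> has level at least
      \<open>n - 2\<close>, and all vertices other than \<open>z\<close> and \<open>c\<close> are
      below \<open>n - 2\<close>.\<close>
    have nbr: "u = c \<or> h u = n - 3 \<and> h z = n - 2" if "z \<rightarrow>\<^bsub>G\<^esub> u" for u
    proof -
      have "u \<in> verts G" "u \<noteq> z" using that adj_in_verts adj_not_same by blast+
      then show ?thesis using low'[of u] step[OF that] hzn by linarith
    qed
    have "z1 = c \<or> z2 = c"
    proof (rule ccontr)
      assume "\<not> ?thesis"
      then have "h z1 = n - 3" "h z2 = n - 3" using nbr zz by auto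
      moreover have "n - 3 < n - 2" using n5 by linarith
      ultimately show False using unique[of z1 z2] zz adj_in_verts by auto
    qed
    then obtain d where d: "z \<rightarrow>\<^bsub>G\<^esub> c" "z \<rightarrow>\<^bsub>G\<^esub> d" "c \<noteq> d" using zz by blast
    then have hd: "h d = n - 3" "h z = n - 2" using nbr by auto
    \<comment> \<open>Otherwise a shortest path from \<open>c\<close> to \<open>v\<close> would go
      to \<open>z\<close> in one step, although \<open>long\<close> puts \<open>z\<close> at
      distance at least \<open>n - 2\<close> from \<open>c\<close>.\<close>
    have "h c \<noteq> n - 1"
    proof
      assume hc: "h c = n - 1"
      then have "n - 2 \<le> hops c v" by (simp add: h_def)
      then obtain y where y: "y \<in> verts G" "h y = n - 2" "hops c y \<le> h c - (n - 2)"
        using hops_level[OF cV vV] unfolding h_def by blast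
      have "y \<noteq> c" using y hc n5 by auto
      then have "y = z" using low'[of y] y by auto
      with y hc long[OF d] n5 show False by simp
    qed
    with top[OF cV] have hc: "h c \<le> n - 2" by linarith
    show ?thesis
      \<comment> \<open>Now \<open>v\<close> and \<open>z\<close> play the roles of \<open>a\<close>
        and \<open>b\<close>.\<close>
      by (rule adjacent_chords[OF vzc d]) (use hd hc n5 in \<open>auto simp: h_def n_def\<close>)
  qed
qed

end

section \<open>The upper bound for the theta digraph\<close>

lemma path_arcs_simps [simp]:
  "path_arcs [x] = {}" "path_arcs (x # y # xs) = insert (x, y) (path_arcs (y # xs))"
  by (auto simp: path_arcs_def)

lemma path_arcs_upt_snoc:
  "path_arcs ([m..<Suc (m + k)] @ [z]) = insert (m + k, z) ((\<lambda>i. (i, Suc i)) ` {m..<m + k})"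
proof (induction k arbitrary: m)
  case 0
  then show ?case by simp
next
  case (Suc k)
  have upt: "[m..<Suc (m + Suc k)] = m # [Suc m..<Suc (Suc m + k)]"
    "[Suc m..<Suc (Suc m + k)] = Suc m # [Suc (Suc m)..<Suc (Suc m + k)]"
    by (simp_all add: upt_conv_Cons del: upt_Suc)
  have "path_arcs ([m..<Suc (m + Suc k)] @ [z]) =
      insert (m, Suc m) (path_arcs ([Suc m..<Suc (Suc m + k)] @ [z]))"
    by (simp only: upt append_Cons path_arcs_simps)
  also have "\<dots> = insert (m + Suc k, z) (insert (m, Suc m) ((\<lambda>i. (i, Suc i)) ` {Suc m..<m + Suc k}))"
    unfolding Suc by auto
  also have "insert (m, Suc m) ((\<lambda>i. (i, Suc i)) ` {Suc m..<m + Suc k})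
      = (\<lambda>i. (i, Suc i)) ` {m..<m + Suc k}"
  proof -
    have "{m..<m + Suc k} = insert m {Suc m..<m + Suc k}" by auto
    then show ?thesis by (simp only: image_insert)
  qed
  finally show ?case .
qed

text \<open>With \<open>n = c + 5\<close> vertices, the vector \<open>x\<close> satisfies every row
  with equality: each vertex other than 1 has a single out-neighbour, whose entry is
  \<open>t\<close> times larger, and the row of the branch vertex 1 is the equation for
  \<open>t\<close>.\<close>

lemma lambda_alpha_theta_le:
  assumes \<alpha>: "0 \<le> \<alpha>" "\<alpha> < 1" and t: "0 < t"
    and eq: "(t - \<alpha> / (1 - \<alpha>)) * t ^ (c + 4) = t ^ 2 + 1"
  shows "lambda_alpha \<alpha> (theta 0 2 (Suc c)) \<le> \<alpha> + (1 - \<alpha>) * t"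
proof -
  define H where "H = theta 0 2 (Suc c)"
  define E where "E = {(1, 0), (1, 2), (2, 3), (3, 0), (0, 4)} \<union>
    insert (c + 4, 1) ((\<lambda>i. (i, Suc i)) ` {4..<c + 4})"
  have upt: "[4..<5 + c] = 4 # [5..<5 + c]" by (simp add: upt_conv_Cons)
  have "path_arcs (0 # [4..<5 + c] @ [1]) = insert (0, 4) (path_arcs ([4..<5 + c] @ [1]))"
    unfolding upt by simp
  also have "path_arcs ([4..<5 + c] @ [1]) = insert (c + 4, 1) ((\<lambda>i. (i, Suc i)) ` {4..<c + 4})"
    using path_arcs_upt_snoc[of 4 c 1] by (simp add: add.commute)
  finally have H: "verts H = {0..<c + 5}" "arcs H = E" "tail H = fst" "head H = snd"
    by (auto simp: H_def theta_def E_def numeral_eq_Suc)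
  have ends: "arcs_ends H = E" by (simp add: arcs_ends_def arc_to_ends_def[abs_def] H)
  interpret H: fin_digraph H by unfold_locales (auto simp: H E_def)
  interpret H: nomulti_digraph H by unfold_locales (auto simp: H arc_to_ends_def)
  \<comment> \<open>The exponent is \<open>n - 1\<close> minus the distance to vertex 1, as in
    \<open>lambda_alpha_greater_short_cycle\<close>.\<close>
  define x where "x u = t ^ (if u = 0 then 2 else if u = 1 then c + 4 else if u = 2 then 0
    else if u = 3 then 1 else u - 1)" for u :: nat
  have "lambda_alpha \<alpha> H \<le> \<alpha> + (1 - \<alpha>) * t"
  proof (rule H.lambda_alpha_leI[where x = x])
    fix u assume u: "u \<in> verts H"
    show "\<alpha> * real (out_degree H u) * x u + (1 - \<alpha>) * (\<Sum>w | u \<rightarrow>\<^bsub>H\<^esub> w. x w) \<le> (\<alpha> + (1 - \<alpha>) * t) * x u"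
    proof (cases "u = 1")
      case True
      then have "{w. u \<rightarrow>\<^bsub>H\<^esub> w} = {0, 2}" by (auto simp: ends E_def)
      then have "\<alpha> * real (out_degree H u) * x u + (1 - \<alpha>) * (\<Sum>w | u \<rightarrow>\<^bsub>H\<^esub> w. x w)
          = 2 * \<alpha> * t ^ (c + 4) + (1 - \<alpha>) * ((t - \<alpha> / (1 - \<alpha>)) * t ^ (c + 4))"
        unfolding eq using True H.card_out_neighbours[of u, symmetric] by (simp add: x_def)
      also have "(1 - \<alpha>) * ((t - \<alpha> / (1 - \<alpha>)) * t ^ (c + 4)) = ((1 - \<alpha>) * t - \<alpha>) * t ^ (c + 4)"
        using \<alpha> by (simp add: field_simps)
      finally show ?thesis using True by (simp add: x_def algebra_simps)
    next
      case False
      have "\<exists>w. {w. u \<rightarrow>\<^bsub>H\<^esub> w} = {w} \<and> x w = t * x u"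
      proof -
        consider "u = 0" | "u = 2" | "u = 3" | "4 \<le> u" "u < c + 4" | "u = c + 4"
          using u False by (force simp: H)
        then show ?thesis
        proof cases
          case 1
          then show ?thesis by (intro exI[of _ 4]) (auto simp: ends E_def x_def numeral_eq_Suc)
        next
          case 2
          then show ?thesis by (intro exI[of _ 3]) (auto simp: ends E_def x_def)
        next
          case 3
          then show ?thesis by (intro exI[of _ 0]) (auto simp: ends E_def x_def power2_eq_square)
        next
          case 4
          then show ?thesis by (intro exI[of _ "Suc u"])
              (auto simp: ends E_def x_def power_Suc[symmetric] simp del: power_Suc)
        next
          case 5
          then show ?thesis by (intro exI[of _ 1]) (auto simp: ends E_def x_def numeral_eq_Suc)
        qed
      qed
      then obtain w where w: "{w. u \<rightarrow>\<^bsub>H\<^esub> w} = {w}" "x w = t * x u" by blast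
      then have "out_degree H u = 1" using H.card_out_neighbours[of u, symmetric] by simp
      with w show ?thesis by (simp add: algebra_simps)
    qed
  qed (use \<alpha> t in \<open>auto simp: H x_def\<close>)
  then show ?thesis by (simp add: H_def)
qed

section \<open>Strongly connected digraphs with as many arcs as vertices\<close>

context strongly_connected_digraph
begin

lemma out_degree_pos:
  assumes "2 \<le> card (verts G)" "u \<in> verts G"
  shows "1 \<le> out_degree G u"
proof -
  have "card (verts G - {u}) \<noteq> 0" using assms by simp
  then obtain v where "v \<in> verts G" "u \<noteq> v" by (cases "verts G - {u} = {}") auto
  then obtain w where "u \<rightarrow>\<^bsub>G\<^esub> w" using hops_next[OF assms(2)] by blast
  then have "card {w. u \<rightarrow>\<^bsub>G\<^esub> w} \<noteq> 0" using finite_out_neighbours by (auto simp: card_eq_0_iff)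
  then show ?thesis by (simp add: card_out_neighbours)
qed

lemma card_verts_le_card_arcs:
  assumes "2 \<le> card (verts G)"
  shows "card (verts G) \<le> card (arcs G)"
proof -
  have "(\<Sum>u\<in>verts G. 1) \<le> (\<Sum>u\<in>verts G. out_degree G u)"
    using out_degree_pos[OF assms] by (intro sum_mono) auto
  then show ?thesis by (simp add: sum_out_degree)
qed

text \<open>All outdegrees are one, so arcs are the graph of a function \<open>g\<close>. By strong
  connectivity the \<open>g\<close>-orbit of any vertex is everything, and positions along the orbit
  give the isomorphism.\<close>

lemma digraph_iso_directed_cycle:
  assumes n: "card (verts G) = n" "2 \<le> n" and arcs: "card (arcs G) = n"
  shows "digraph_iso G (directed_cycle n)"
proof -
  have "out_degree G u = 1" if u: "u \<in> verts G" for u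
  proof (rule ccontr)
    assume "out_degree G u \<noteq> 1"
    then have "1 < out_degree G u" using out_degree_pos u n by fastforce
    then have "(\<Sum>u\<in>verts G. 1) < (\<Sum>u\<in>verts G. out_degree G u)"
      using out_degree_pos n u by (intro sum_strict_mono_ex1) auto
    then show False using arcs n by (simp add: sum_out_degree)
  qed
  then have "\<exists>w. {w. u \<rightarrow>\<^bsub>G\<^esub> w} = {w}" if "u \<in> verts G" for u
    using that card_out_neighbours[of u] by (simp add: card_1_singleton_iff)
  then obtain g where g: "\<And>u. u \<in> verts G \<Longrightarrow> {w. u \<rightarrow>\<^bsub>G\<^esub> w} = {g u}" by metis
  have gV: "g u \<in> verts G" if "u \<in> verts G" for u using g[OF that] adj_in_verts(2) by blast
  have relpow: "w = (g ^^ k) u" if "(u, w) \<in> arcs_ends G ^^ k" "u \<in> verts G" for u w k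
    using that
  proof (induction k arbitrary: w)
    case (Suc k)
    then obtain y where y: "(u, y) \<in> arcs_ends G ^^ k" "y \<rightarrow>\<^bsub>G\<^esub> w" by auto
    then have "y = (g ^^ k) u" "y \<in> verts G" using Suc adj_in_verts by blast+
    then show ?case using g[of y] y(2) by auto
  qed simp
  obtain v where v: "v \<in> verts G" using n by fastforce
  define c where "c k = (g ^^ k) v" for k
  have cV: "c k \<in> verts G" for k by (induction k) (auto simp: c_def v gV)
  \<comment> \<open>A return time of \<open>v\<close>: one arc to \<open>g v\<close>, then a
    shortest path back. It is at most \<open>n\<close> by the bound on distances and at least
    \<open>n\<close> because the orbit covers all vertices.\<close>
  define p where "p = Suc (hops (g v) v)"
  have "p \<le> n" using hops_less_card[OF gV[OF v] v] n by (simp add: p_def)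
  have "v = (g ^^ hops (g v) v) (g v)" using relpow_hops gV v by (intro relpow) auto
  then have cp: "(g ^^ p) v = v" by (simp add: p_def funpow_swap1)
  have cmod: "c (k mod p) = c k" for k unfolding c_def using cp by (rule funpow_mod_eq)
  have cover: "verts G \<subseteq> c ` {..<p}"
  proof
    fix w assume w: "w \<in> verts G"
    have "w = c (hops v w)" unfolding c_def using relpow_hops v w by (intro relpow) auto
    then have "w = c (hops v w mod p)" by (simp add: cmod)
    then show "w \<in> c ` {..<p}" by (auto simp: p_def)
  qed
  have "n \<le> card (c ` {..<p})" unfolding n(1)[symmetric] using cover by (intro card_mono) auto
  also have "\<dots> \<le> p" using card_image_le[of "{..<p}" c] by simp
  finally have pn: "p = n" using \<open>p \<le> n\<close> by simp
  have img: "c ` {..<n} = verts G" using cover cV pn by auto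
  have inj: "inj_on c {..<n}" using img n by (intro eq_card_imp_inj_on) auto
  define \<phi> where "\<phi> = the_inv_into {..<n} c"
  have \<phi>c: "\<phi> (c k) = k mod n" for k
  proof -
    have "\<phi> (c (k mod n)) = k mod n"
      unfolding \<phi>_def using n by (intro the_inv_into_f_f[OF inj]) auto
    then show ?thesis using cmod[of k] pn by simp
  qed
  have inj\<phi>: "inj_on \<phi> (verts G)"
    unfolding \<phi>_def img[symmetric] by (rule inj_on_the_inv_into[OF inj])
  have img\<phi>: "\<phi> ` verts G = {0..<n}"
  proof -
    have "\<phi> ` verts G = (\<lambda>k. k mod n) ` {..<n}" unfolding img[symmetric] image_image \<phi>c ..
    also have "\<dots> = {0..<n}" by (auto simp: lessThan_atLeast0)
    finally show ?thesis .
  qed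
  \<comment> \<open>Arcs of \<open>directed_cycle\<close> are pairs, so an arc is sent to the pair
    of images of its ends; this is injective in the absence of parallel arcs.\<close>
  define hom where "hom = \<lparr>iso_verts = \<phi>, iso_arcs = (\<lambda>e. (\<phi> (tail G e), \<phi> (head G e))),
    iso_head = snd, iso_tail = fst\<rparr>"
  have "digraph_isomorphism hom"
    unfolding digraph_isomorphism_def
  proof (intro conjI ballI)
    show "inj_on (iso_arcs hom) (arcs G)"
    proof (rule inj_onI)
      fix e e' assume e: "e \<in> arcs G" "e' \<in> arcs G" "iso_arcs hom e = iso_arcs hom e'"
      then have "arc_to_ends G e = arc_to_ends G e'"
        using inj\<phi> by (auto simp: hom_def arc_to_ends_def inj_on_eq_iff)
      then show "e = e'" using e no_multi_arcs by blast
    qed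
  qed (use inj\<phi> wf_digraph in \<open>auto simp: hom_def\<close>)
  moreover have "directed_cycle n = app_iso hom G"
  proof -
    have "(\<lambda>e. (\<phi> (tail G e), \<phi> (head G e))) ` arcs G = (\<lambda>(u, w). (\<phi> u, \<phi> w)) ` arcs_ends G"
      by (simp add: arcs_ends_conv image_image)
    also have "arcs_ends G = (\<lambda>u. (u, g u)) ` verts G"
    proof -
      have "u \<rightarrow>\<^bsub>G\<^esub> w \<longleftrightarrow> u \<in> verts G \<and> w = g u" for u w
        using g[of u] adj_in_verts(1)[of u w] by auto
      then show ?thesis by auto
    qed
    also have "\<dots> = (\<lambda>k. (c k, c (Suc k))) ` {..<n}"
      unfolding img[symmetric] by (simp add: image_image c_def)
    also have "(\<lambda>(u, w). (\<phi> u, \<phi> w)) ` \<dots> = (\<lambda>k. (k mod n, Suc k mod n)) ` {..<n}"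
      by (simp add: image_image \<phi>c)
    also have "\<dots> = path_arcs ([0..<n] @ [0])"
    proof -
      obtain m where m: "n = Suc m" using n(2) by (cases n) auto
      have "path_arcs ([0..<n] @ [0]) = insert (m, 0) ((\<lambda>i. (i, Suc i)) ` {0..<m})"
        using path_arcs_upt_snoc[of 0 m 0] by (simp only: m add_0)
      moreover have "(\<lambda>k. (k mod n, Suc k mod n)) ` {..<n} = insert (m, 0) ((\<lambda>i. (i, Suc i)) ` {0..<m})"
        unfolding m lessThan_Suc image_insert atLeast0LessThan
        by (intro arg_cong2[where f = insert] image_cong) auto
      ultimately show ?thesis by simp
    qed
    finally show ?thesis using img\<phi> by (simp add: directed_cycle_def app_iso_def hom_def)
  qed
  ultimately show ?thesis unfolding digraph_iso_def by blast
qed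

end

section \<open>The number \<open>t\<close> and the conclusion\<close>

text \<open>Intermediate value theorem: the difference of the two sides is negative at 1, and at 2
  it is at least 16 - 5 because \<open>2 - s \<ge> 1\<close>.\<close>

lemma theta_equation_root:
  fixes s :: real
  assumes s: "0 \<le> s" "s \<le> 1" and n: "5 \<le> n"
  obtains t where "1 < t" "t < 2" "(t - s) * t ^ (n - 1) = t ^ 2 + 1"
proof -
  define f where "f t = (t - s) * t ^ (n - 1) - t ^ 2 - 1" for t
  have f1: "f 1 < 0" using s by (simp add: f_def)
  have "(2::real) ^ 4 \<le> 2 ^ (n - 1)" using n by (intro power_increasing) auto
  then have "1 * 16 \<le> (2 - s) * 2 ^ (n - 1)" using s by (intro mult_mono) auto
  then have f2: "0 < f 2" by (simp add: f_def)
  have "\<exists>t\<ge>1. t \<le> 2 \<and> f t = 0"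
    using f1 f2 by (intro IVT') (auto simp: f_def intro!: continuous_intros)
  then obtain t where t: "1 \<le> t" "t \<le> 2" "f t = 0" by blast
  moreover have "t \<noteq> 1" "t \<noteq> 2" using t f1 f2 by auto
  ultimately show ?thesis by (intro that[of t]) (auto simp: f_def)
qed

theorem theorem3p4:
  fixes G :: "('a, 'b) pre_digraph" and n :: nat and \<alpha> :: real
  assumes "0 \<le> \<alpha>" and "\<alpha> \<le> 1 / 2"
    and "digraph G" and "strongly_connected G"
    and "card (verts G) = n" and "n \<ge> 5"
    and "\<not> bicyclic G"
    and "\<not> digraph_iso G (directed_cycle n)"
  shows "lambda_alpha \<alpha> G > lambda_alpha \<alpha> (theta 0 2 (n - 4))"
proof -
  interpret strongly_connected_digraph G
    using assms by (auto simp: strongly_connected_digraph_def strongly_connected_digraph_axioms_def)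
  have \<alpha>: "0 \<le> \<alpha>" "\<alpha> < 1" and s: "0 \<le> \<alpha> / (1 - \<alpha>)" "\<alpha> / (1 - \<alpha>) \<le> 1"
    using assms(1,2) by (auto simp: field_simps)
  obtain t where t: "1 < t" "t < 2" and eq: "(t - \<alpha> / (1 - \<alpha>)) * t ^ (n - 1) = t ^ 2 + 1"
    using theta_equation_root[OF s \<open>n \<ge> 5\<close>] by blast
  obtain c where c: "n - 1 = c + 4" "n - 4 = Suc c"
    using \<open>n \<ge> 5\<close> by (intro that[of "n - 5"]) auto
  \<comment> \<open>The two excluded families are exactly those with \<open>n\<close> and
    \<open>n + 1\<close> arcs, and strong connectivity forces at least \<open>n\<close>.\<close>
  have "card (arcs G) \<noteq> n" "card (arcs G) \<noteq> n + 1"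
    using digraph_iso_directed_cycle assms by (auto simp: bicyclic_def)
  with card_verts_le_card_arcs assms have arcs: "card (arcs G) \<ge> card (verts G) + 2" by simp
  have n5: "5 \<le> card (verts G)" using assms by simp
  have "lambda_alpha \<alpha> (theta 0 2 (n - 4)) \<le> \<alpha> + (1 - \<alpha>) * t"
    using lambda_alpha_theta_le[OF \<alpha>, of t c] t eq unfolding c by simp
  also have "\<dots> < lambda_alpha \<alpha> G"
    using n5 arcs
  proof (cases rule: short_cycle_or_adjacent_chords)
    case (short_cycle v w1 w2)
    with \<alpha> t eq arcs assms show ?thesis
      by (intro lambda_alpha_greater_short_cycle[of \<alpha> t v w1 w2]) auto
  next
    case (adjacent_chords a b c d)
    moreover have "\<alpha> / (1 - \<alpha>) < t" using s t by linarith
    ultimately show ?thesis using \<alpha> t eq assms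
      by (intro lambda_alpha_greater_adjacent_chords[of \<alpha> t a b c d]) auto
  qed
  finally show ?thesis .
qed

end
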